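(* Let $A$ be an integral $(d+1)\times d$ matrix of rank $d$ with rows $a_0,a_1,\dots,a_d$, and suppose there is a row vector $y=(y_0,\dots,y_d)$ of positive integers with $yA=0$, i.e. $y_0a_0+\cdots+y_da_d=0$. For $\epsilon>0$ small put $$a_0' := a_0+\epsilon a_1+\cdots+\epsilon^d a_d .$$ Let $T$ be a test set for the family of integer programs given by $$\min\{a_0' z\mid z\in\mathbb{Z}^d,\ a_1z\le b_1,\ \dots,\ a_dz\le b_d\},$$ where $b_1,\dots,b_d\in\mathbb{Z}$. Let $K_b$ be a maximal lattice free body such that $b=(0,b_1,\dots,b_d)^t\in\mathbb{N}^{d+1}$ with $b_1,\dots,b_d>0$, and such that $0$ is the optimal solution of the integer program $$\min\{a_0' z\mid z\in\mathbb{Z}^d,\ a_1z\le b_1-1,\ \dots,\ a_dz\le b_d-1\}.$$ Then there exists a $d$-tuple $(z_1,\dots,z_d)$ of elements of $T$ such that, for $i=1,\dots,d$, (a) $a_iz_i>0$; (b) $a_iz_j<a_iz_i$ for all $j\in\{1,\dots,d\}$ with $j\ne i$; (c) there exists no $z\in T$ with $a_kz<a_kz_k$ for all $k=1,\dots,d$; (d) $a_0z_i\le 0$.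
   Context: $\mathbb{N}$ denotes the natural numbers including $0$. For $b\in\mathbb{R}^{d+1}$ put $K_b=\{x\in\mathbb{R}^d\mid Ax\le b\}$ (coordinatewise inequalities). A convex body is a compact convex subset of $\mathbb{R}^d$ with non-empty interior; it is lattice free if its interior contains no point of $\mathbb{Z}^d$. A maximal lattice free body is a lattice free convex body that is maximal with respect to inclusion among all lattice free convex bodies in $\mathbb{R}^d$. A test set for the family of integer programs $\min\{a_0'z\mid z\in\mathbb{Z}^d,\ a_1z\le b_1,\dots,a_dz\le b_d\}$, with $(b_1,\dots,b_d)$ ranging over $\mathbb{Z}^d$, is a finite set $T\subset\mathbb{Z}^d$ such that (i) $a_0'v<0$ for every $v\in T$; and (ii) for every $(b_1,\dots,b_d)\in\mathbb{Z}^d$, a feasible point $v_0\in\mathbb{Z}^d$ of the corresponding program (i.e. $a_iv_0\le b_i$ for $i=1,\dots,d$) is optimal if and only if for every $v\in T$ the point $v_0+v$ is not feasible for that program. "For $\epsilon>0$ small" means: there is $\epsilon_0>0$, depending only on $A$, such that the statement holds for every fixed $\epsilon$ with $0<\epsilon<\epsilon_0$. *)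

theory Defs
  imports "HOL-Analysis.Analysis"
begin

text \<open>The dimension d is \<open>CARD('n)\<close>. A matrix with rows \<open>a\<^sub>0, \<dots>, a\<^sub>d\<close> is given by its family of
  rows \<open>a :: nat \<Rightarrow> real^'n\<close>, of which only the values at indices \<open>\<le> CARD('n)\<close> matter; the same
  convention applies to right-hand sides and to the multipliers y.\<close>

definition integer_points :: "(real^'n::finite) set" where
  "integer_points = {x. \<forall>k. x $ k \<in> \<int>}"

definition row_polyhedron :: "(nat \<Rightarrow> real^'n::finite) \<Rightarrow> (nat \<Rightarrow> real) \<Rightarrow> (real^'n) set" where
  "row_polyhedron a b = {x. \<forall>i\<in>{0..CARD('n)}. a i \<bullet> x \<le> b i}"

text \<open>On a matrix of type \<open>real^'n^'m\<close> the library's \<open>rank\<close> is the dimension of the span of the set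
  of rows; the following is the same quantity for a matrix given as a family of rows.\<close>

definition rows_rank :: "(nat \<Rightarrow> real^'n::finite) \<Rightarrow> nat" where
  "rows_rank a = dim (a ` {0..CARD('n)})"

definition convex_body :: "(real^'n::finite) set \<Rightarrow> bool" where
  "convex_body K \<longleftrightarrow> compact K \<and> convex K \<and> interior K \<noteq> {}"

definition lattice_free_body :: "(real^'n::finite) set \<Rightarrow> bool" where
  "lattice_free_body K \<longleftrightarrow> convex_body K \<and> interior K \<inter> integer_points = {}"

definition maximal_lattice_free_body :: "(real^'n::finite) set \<Rightarrow> bool" where
  "maximal_lattice_free_body K \<longleftrightarrow>
     lattice_free_body K \<and> (\<forall>L. lattice_free_body L \<and> K \<subseteq> L \<longrightarrow> L = K)"

text \<open>In the integer programs only the rows \<open>a\<^sub>1, \<dots>, a\<^sub>d\<close> are constraints; row 0 enters through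
  the objective.\<close>

definition ip_feasible :: "(nat \<Rightarrow> real^'n::finite) \<Rightarrow> (nat \<Rightarrow> int) \<Rightarrow> real^'n \<Rightarrow> bool" where
  "ip_feasible a b z \<longleftrightarrow> z \<in> integer_points \<and> (\<forall>i\<in>{1..CARD('n)}. a i \<bullet> z \<le> of_int (b i))"

definition ip_optimal ::
  "(nat \<Rightarrow> real^'n::finite) \<Rightarrow> real^'n \<Rightarrow> (nat \<Rightarrow> int) \<Rightarrow> real^'n \<Rightarrow> bool" where
  "ip_optimal a c b z \<longleftrightarrow> ip_feasible a b z \<and> (\<forall>w. ip_feasible a b w \<longrightarrow> c \<bullet> z \<le> c \<bullet> w)"

definition test_set ::
  "(nat \<Rightarrow> real^'n::finite) \<Rightarrow> real^'n \<Rightarrow> (real^'n) set \<Rightarrow> bool" where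
  "test_set a c T \<longleftrightarrow>
     finite T \<and> T \<subseteq> integer_points \<and> (\<forall>v\<in>T. c \<bullet> v < 0) \<and>
     (\<forall>b v0. ip_feasible a b v0 \<longrightarrow>
        (ip_optimal a c b v0 \<longleftrightarrow> (\<forall>v\<in>T. \<not> ip_feasible a b (v0 + v))))"

definition perturbed_objective :: "(nat \<Rightarrow> real^'n::finite) \<Rightarrow> real \<Rightarrow> real^'n" where
  "perturbed_objective a \<epsilon> = (\<Sum>i=0..CARD('n). \<epsilon> ^ i *\<^sub>R a i)"

end

theory Submission
  imports Defs
begin

text \<open>
  Write c for the perturbed objective. Since \<open>K\<^sub>b\<close> is maximal and all data are integral, each facet
  of \<open>K\<^sub>b\<close> contains a lattice point in its relative interior: otherwise that facet could be moved
  outwards by 1/2 without a lattice point entering the interior (\<open>lattice_point_on_facet\<close>).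
  For \<open>i \<ge> 1\<close> let x be such a point on facet i. As \<open>b\<^sub>0 = 0\<close>, it satisfies \<open>a\<^sub>0 x \<le> -1\<close>, so
  \<open>c x < 0\<close> for small \<open>\<epsilon>\<close>.

  Take the program with right-hand side \<open>b - 1\<close> in which row i alone is relaxed to \<open>b\<^sub>i\<close>. There x is
  feasible and better than 0, so the test set supplies \<open>z\<^sub>i \<in> T\<close> feasible for the relaxed program.
  In the unrelaxed program 0 is optimal, so no vector of T is feasible for it; hence \<open>z\<^sub>i\<close> uses the
  relaxation: \<open>a\<^sub>i z\<^sub>i = b\<^sub>i\<close>, while \<open>a\<^sub>j z\<^sub>i \<le> b\<^sub>j - 1\<close> for the other \<open>j \<ge> 1\<close>
  (\<open>test_vector_on_facet\<close>). Conditions (a) and (b) follow by comparing values with b, and (c) says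
  again that no vector of T is feasible for the unrelaxed program. If (d) failed, then
  \<open>a\<^sub>0 z\<^sub>i \<ge> 1\<close>, which for small \<open>\<epsilon>\<close> is incompatible with \<open>c z\<^sub>i < 0\<close>.

  Both comparisons between \<open>a\<^sub>0\<close> and c (\<open>perturbed_objective_sign\<close>) need a threshold for \<open>\<epsilon>\<close> that is
  uniform in b. It exists because a nonnegative b with \<open>K\<^sub>b\<close> lattice free is bounded in terms of the
  matrix (\<open>lattice_free_rhs_bounded\<close>): up to translation, \<open>K\<^sub>b\<close> depends only on \<open>y b\<close>, and once
  that number is large, rounding a central point of the simplex gives an interior lattice point.
\<close>

section \<open>Matrices whose rows satisfy a positive integral relation\<close>

locale simplex_matrix =
  fixes a :: "nat \<Rightarrow> real^'n::finite" and y :: "nat \<Rightarrow> int"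
  assumes integral: "\<forall>i\<in>{0..CARD('n)}. a i \<in> integer_points"
    and rank: "rows_rank a = CARD('n)"
    and y_pos: "\<forall>i\<in>{0..CARD('n)}. y i > 0"
    and y_rel: "(\<Sum>i=0..CARD('n). of_int (y i) *\<^sub>R a i) = 0"
begin

lemma weighted_row_values_sum_zero:
  "(\<Sum>i=0..CARD('n). of_int (y i) * (a i \<bullet> x)) = 0"
proof -
  have "(\<Sum>i=0..CARD('n). of_int (y i) * (a i \<bullet> x)) = (\<Sum>i=0..CARD('n). of_int (y i) *\<^sub>R a i) \<bullet> x"
    by (simp add: inner_sum_left)
  then show ?thesis
    using y_rel by simp
qed

lemma weighted_tail_sum:
  "(\<Sum>i=1..CARD('n). of_int (y i) * (a i \<bullet> x)) = - of_int (y 0) * (a 0 \<bullet> x)"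
  using weighted_row_values_sum_zero[of x] by (simp add: sum.atLeast_Suc_atMost)

lemma y_ge_1:
  assumes "i \<le> CARD('n)"
  shows "real_of_int (y i) \<ge> 1"
proof -
  have "y i > 0"
    using y_pos assms by simp
  then show ?thesis
    by simp
qed

lemma row_value_integer:
  assumes "x \<in> integer_points" "i \<le> CARD('n)"
  shows "a i \<bullet> x \<in> \<int>"
proof -
  have "a i \<in> integer_points"
    using integral assms(2) by simp
  then show ?thesis
    using assms(1) unfolding inner_vec_def integer_points_def by (auto intro!: Ints_sum Ints_mult)
qed

lemma row_value_le_pred_iff:
  assumes "x \<in> integer_points" "i \<le> CARD('n)"
  shows "a i \<bullet> x \<le> of_int (m - 1) \<longleftrightarrow> a i \<bullet> x < of_int m"
proof -
  obtain n where "a i \<bullet> x = of_int n"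
    using row_value_integer[OF assms] by (rule Ints_cases)
  then show ?thesis
    by (simp only: of_int_less_iff of_int_le_iff) linarith
qed

lemma eq_zero_if_row_values_zero:
  assumes "\<forall>i\<in>{1..CARD('n)}. a i \<bullet> x = 0"
  shows "x = 0"
proof -
  have "a 0 \<bullet> x = 0"
    using weighted_tail_sum[of x] assms y_ge_1[of 0] by force
  then have "orthogonal x v" if "v \<in> a ` {0..CARD('n)}" for v
    using that assms by (auto simp: orthogonal_def inner_commute Suc_le_eq)
  moreover have "span (a ` {0..CARD('n)}) = UNIV"
    using rank by (simp add: rows_rank_def flip: dim_eq_full)
  ultimately have "orthogonal x x"
    using orthogonal_to_span by blast
  then show ?thesis
    by (simp add: orthogonal_def)
qed

text \<open>The rows \<open>1, \<dots>, d\<close> form an invertible square matrix f; the bijection h only translates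
  between the index type and the row numbers.\<close>

lemma row_values_linear_iso:
  obtains h and f :: "real^'n \<Rightarrow> real^'n"
  where "bij_betw h (UNIV :: 'n set) {1..CARD('n)}" "linear f" "inj f" "\<And>x k. f x $ k = a (h k) \<bullet> x"
proof -
  obtain h where h: "bij_betw h (UNIV :: 'n set) {1..CARD('n)}"
    using finite_same_card_bij[of "UNIV :: 'n set" "{1..CARD('n)}"] by auto
  define f :: "real^'n \<Rightarrow> real^'n" where "f x = (\<chi> k. a (h k) \<bullet> x)" for x
  have lin: "linear f"
    by (rule linearI) (auto simp: f_def vec_eq_iff inner_add_right)
  have "x = 0" if "f x = 0" for x
  proof (rule eq_zero_if_row_values_zero, rule ballI)
    fix i assume "i \<in> {1..CARD('n)}"
    then obtain k where "i = h k"
      using bij_betw_imp_surj_on[OF h] by blast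
    then show "a i \<bullet> x = 0"
      using that by (simp add: f_def vec_eq_iff)
  qed
  then have "inj f"
    using lin linear_injective_0 by blast
  then show thesis
    using that h lin by (simp add: f_def)
qed

text \<open>The column space of the matrix is exactly the hyperplane orthogonal to y: rows \<open>1, \<dots>, d\<close>
  can be prescribed freely, and y then forces the value of row 0.\<close>

lemma solvable_row_values:
  assumes "(\<Sum>i=0..CARD('n). of_int (y i) * c i) = 0"
  obtains x where "\<And>i. i \<le> CARD('n) \<Longrightarrow> a i \<bullet> x = c i"
proof -
  obtain h and f :: "real^'n \<Rightarrow> real^'n" where h: "bij_betw h (UNIV :: 'n set) {1..CARD('n)}"
    and f: "linear f" "inj f" "\<And>x k. f x $ k = a (h k) \<bullet> x"
    using row_values_linear_iso by blast
  obtain x where x: "f x = (\<chi> k. c (h k))"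
    using linear_injective_imp_surjective[OF f(1,2)] by (metis surjD)
  have pos: "a i \<bullet> x = c i" if i: "i \<in> {1..CARD('n)}" for i
  proof -
    obtain k where "i = h k"
      using bij_betw_imp_surj_on[OF h] i by blast
    then show ?thesis
      using f(3)[of x k] x by simp
  qed
  have "of_int (y 0) * c 0 = - (\<Sum>i=1..CARD('n). of_int (y i) * c i)"
    using assms by (simp add: sum.atLeast_Suc_atMost)
  also have "\<dots> = - (\<Sum>i=1..CARD('n). of_int (y i) * (a i \<bullet> x))"
    using pos by simp
  also have "\<dots> = of_int (y 0) * (a 0 \<bullet> x)"
    using weighted_tail_sum by simp
  moreover have "y 0 > 0"
    using y_pos by simp
  ultimately have "a 0 \<bullet> x = c 0"
    by simp
  with pos have "a i \<bullet> x = c i" if "i \<le> CARD('n)" for i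
    using that by (cases "i = 0") auto
  then show thesis
    using that by blast
qed

text \<open>Such a direction crosses facet i and no other facet. It exists because the positive value on
  row i can be balanced, in the relation y, by a negative value on any single other row.\<close>

lemma direction_leaving_one_facet:
  assumes "i \<le> CARD('n)"
  obtains v where "a i \<bullet> v = 1" "\<And>j. j \<le> CARD('n) \<Longrightarrow> j \<noteq> i \<Longrightarrow> a j \<bullet> v \<le> 0"
proof -
  obtain k where k: "k \<le> CARD('n)" "k \<noteq> i"
    by (metis (no_types) One_nat_def less_numeral_extra(1) less_one nat_neq_iff zero_le zero_less_card_finite Suc_leI)
  define c where "c j = (if j = i then 1 else if j = k then - (of_int (y i) / of_int (y k)) else 0 :: real)" for j
  have yk: "y i > 0" "y k > 0"
    using y_pos k(1) assms by auto
  have "(\<Sum>j=0..CARD('n). of_int (y j) * c j) = (\<Sum>j\<in>{i,k}. of_int (y j) * c j)"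
    by (rule sum.mono_neutral_right) (use assms k in \<open>auto simp: c_def\<close>)
  also have "\<dots> = 0"
    using k(2) yk by (simp add: c_def)
  finally obtain v where v: "\<And>j. j \<le> CARD('n) \<Longrightarrow> a j \<bullet> v = c j"
    using solvable_row_values by blast
  show thesis
    by (rule that[of v]) (use v assms yk in \<open>auto simp: c_def\<close>)
qed

lemma row_nonzero:
  assumes "i \<le> CARD('n)"
  shows "a i \<noteq> 0"
  using direction_leaving_one_facet[OF assms] by (metis inner_zero_left zero_neq_one)

text \<open>The positive relation y turns upper bounds on all rows into a lower bound on each of them. The
  dependence on row 0 is kept explicit because that bound is later applied to points on which row 0
  is large.\<close>

lemma row_value_lower_bound:
  assumes x: "\<And>j. j \<in> {1..CARD('n)} \<Longrightarrow> a j \<bullet> x \<le> B" and B: "B \<ge> 0" and i: "i \<in> {1..CARD('n)}"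
  shows "a i \<bullet> x \<ge> - (of_int (y 0) * max 0 (a 0 \<bullet> x)) - (\<Sum>j=1..CARD('n). of_int (y j)) * B"
proof -
  let ?M = "of_int (y 0) * max 0 (a 0 \<bullet> x) + (\<Sum>j=1..CARD('n). of_int (y j)) * B"
  have yi: "of_int (y i) \<ge> (1::real)" and y0: "of_int (y 0) \<ge> (1::real)"
    using y_ge_1 i by auto
  have ypos: "of_int (y j) \<ge> (0::real)" if "j \<in> {1..CARD('n)}" for j
    using y_pos that by (simp add: less_imp_le)
  have M: "?M \<ge> 0"
    using y0 B ypos by (intro add_nonneg_nonneg mult_nonneg_nonneg sum_nonneg) auto
  have "- of_int (y 0) * (a 0 \<bullet> x) =
      of_int (y i) * (a i \<bullet> x) + (\<Sum>j\<in>{1..CARD('n)} - {i}. of_int (y j) * (a j \<bullet> x))"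
    using weighted_tail_sum[of x] sum.remove[OF _ i, of "\<lambda>j. of_int (y j) * (a j \<bullet> x)"] by simp
  moreover have "(\<Sum>j\<in>{1..CARD('n)} - {i}. of_int (y j) * (a j \<bullet> x))
      \<le> (\<Sum>j\<in>{1..CARD('n)} - {i}. of_int (y j) * B)"
    using x ypos by (intro sum_mono mult_left_mono) auto
  moreover have "\<dots> \<le> (\<Sum>j=1..CARD('n). of_int (y j) * B)"
    using ypos B by (intro sum_mono2) auto
  moreover have "of_int (y 0) * (a 0 \<bullet> x) \<le> of_int (y 0) * max 0 (a 0 \<bullet> x)"
    using y0 by (intro mult_left_mono) auto
  ultimately have *: "of_int (y i) * (a i \<bullet> x) \<ge> - ?M"
    by (simp add: sum_distrib_right)
  have "a i \<bullet> x \<ge> - ?M"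
  proof (cases "a i \<bullet> x \<ge> 0")
    case False
    then have "of_int (y i) * (a i \<bullet> x) \<le> 1 * (a i \<bullet> x)"
      using yi by (intro mult_right_mono_neg) auto
    with * show ?thesis
      by simp
  qed (use M in simp)
  then show ?thesis
    by simp
qed

section \<open>Lattice free simplices\<close>

lemma row_polyhedron_as_halfspaces:
  "row_polyhedron a b = (\<Inter>i\<in>{0..CARD('n)}. {x. a i \<bullet> x \<le> b i})"
  by (auto simp: row_polyhedron_def)

text \<open>On the polyhedron every row is bounded on both sides, and the injective map f transports this
  bound to the points themselves.\<close>

lemma compact_row_polyhedron: "compact (row_polyhedron a b)"
proof -
  obtain h and f :: "real^'n \<Rightarrow> real^'n" where h: "bij_betw h (UNIV :: 'n set) {1..CARD('n)}"
    and f: "linear f" "inj f" "\<And>x k. f x $ k = a (h k) \<bullet> x"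
    using row_values_linear_iso by blast
  define B where "B = Max ((\<lambda>i. max 0 (b i)) ` {0..CARD('n)})"
  have B: "b i \<le> B" if "i \<le> CARD('n)" for i
    unfolding B_def by (rule order_trans[OF _ Max_ge[of _ "max 0 (b i)"]]) (use that in auto)
  have B0: "B \<ge> 0"
    unfolding B_def by (rule order_trans[OF _ Max_ge[of _ "max 0 (b 0)"]]) auto
  define C where "C = B + of_int (y 0) * B + (\<Sum>j=1..CARD('n). of_int (y j)) * B"
  have y0: "of_int (y 0) \<ge> (0::real)" "(\<Sum>j=1..CARD('n). real_of_int (y j)) \<ge> 0"
    using y_pos by (auto intro!: sum_nonneg simp: less_imp_le)
  have entry: "\<bar>f x $ k\<bar> \<le> C" if x: "x \<in> row_polyhedron a b" for x k
  proof -
    have hk: "h k \<in> {1..CARD('n)}"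
      using h by (metis bij_betw_apply UNIV_I)
    have le: "a j \<bullet> x \<le> B" if "j \<le> CARD('n)" for j
      using x B[OF that] that by (force simp: row_polyhedron_def)
    have "of_int (y 0) * max 0 (a 0 \<bullet> x) \<le> of_int (y 0) * B"
      using le[of 0] B0 y0 by (intro mult_left_mono) auto
    moreover have "a (h k) \<bullet> x \<ge> - (of_int (y 0) * max 0 (a 0 \<bullet> x)) - (\<Sum>j=1..CARD('n). of_int (y j)) * B"
      using row_value_lower_bound[OF _ B0 hk] le by simp
    moreover have "a (h k) \<bullet> x \<le> B"
      using le hk by simp
    moreover have "of_int (y 0) * B \<ge> 0" "(\<Sum>j=1..CARD('n). of_int (y j)) * B \<ge> 0"
      using y0 B0 by auto
    ultimately show ?thesis
      using B0 unfolding f(3) C_def by linarith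
  qed
  obtain e where e: "e > 0" "\<And>x. norm (f x) \<ge> e * norm x"
    using linear_inj_bounded_below_pos[OF f(1,2)] by blast
  have "norm x \<le> (\<Sum>k\<in>(UNIV::'n set). C) / e" if "x \<in> row_polyhedron a b" for x
  proof -
    have "e * norm x \<le> norm (f x)"
      using e by blast
    also have "\<dots> \<le> (\<Sum>k\<in>UNIV. \<bar>f x $ k\<bar>)"
      by (rule norm_le_l1_cart)
    also have "\<dots> \<le> (\<Sum>k\<in>(UNIV::'n set). C)"
      using entry that by (intro sum_mono) auto
    finally show ?thesis
      using e(1) by (simp add: pos_le_divide_eq mult.commute)
  qed
  then have "bounded (row_polyhedron a b)"
    unfolding bounded_iff by blast
  moreover have "closed (row_polyhedron a b)"
    unfolding row_polyhedron_as_halfspaces by (intro closed_INT ballI closed_halfspace_le)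
  ultimately show ?thesis
    by (simp add: compact_eq_bounded_closed)
qed

lemma interior_row_polyhedron:
  "interior (row_polyhedron a b) = {x. \<forall>i\<in>{0..CARD('n)}. a i \<bullet> x < b i}"
proof -
  have "interior (row_polyhedron a b) \<subseteq> interior {x. a i \<bullet> x \<le> b i}" if "i \<in> {0..CARD('n)}" for i
    using that by (intro interior_mono) (auto simp: row_polyhedron_def)
  then have "interior (row_polyhedron a b) \<subseteq> {x. \<forall>i\<in>{0..CARD('n)}. a i \<bullet> x < b i}"
    using row_nonzero by (force simp: interior_halfspace_le)
  moreover have "{x. \<forall>i\<in>{0..CARD('n)}. a i \<bullet> x < b i} = (\<Inter>i\<in>{0..CARD('n)}. {x. a i \<bullet> x < b i})"
    by auto
  then have "open {x. \<forall>i\<in>{0..CARD('n)}. a i \<bullet> x < b i}"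
    by (auto intro!: open_INT open_halfspace_lt)
  then have "{x. \<forall>i\<in>{0..CARD('n)}. a i \<bullet> x < b i} \<subseteq> interior (row_polyhedron a b)"
    by (intro interior_maximal) (auto simp: row_polyhedron_def less_imp_le)
  ultimately show ?thesis
    by (rule equalityI)
qed

text \<open>The number t below is the common slack of all the inequalities at the central point x of the
  simplex. Rounding x to a lattice point changes the value of row i by at most the
  \<open>\<ell>\<^sub>1\<close>-norm of \<open>a\<^sub>i\<close>, so a larger slack would yield an interior lattice point. The slack is
  proportional to \<open>y b\<close>, and for nonnegative b this number dominates every entry.\<close>

lemma lattice_free_rhs_bounded:
  obtains B :: real where "B > 0"
    and "\<And>b i. lattice_free_body (row_polyhedron a b) \<Longrightarrow> (\<And>i. i \<le> CARD('n) \<Longrightarrow> b i \<ge> 0) \<Longrightarrow>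
          i \<le> CARD('n) \<Longrightarrow> b i \<le> B"
proof -
  define Y where "Y = (\<Sum>i=0..CARD('n). real_of_int (y i))"
  \<comment> \<open>A strict upper bound for the \<open>\<ell>\<^sub>1\<close>-norms of all rows.\<close>
  define m where "m = 1 + (\<Sum>i=0..CARD('n). \<Sum>k\<in>UNIV. \<bar>a i $ k\<bar>)"
  have Y: "Y > 0"
    unfolding Y_def using y_ge_1 by (intro sum_pos) force+
  have m: "m > 0"
    unfolding m_def by (intro add_pos_nonneg sum_nonneg) auto
  have row_m: "(\<Sum>k\<in>UNIV. \<bar>a i $ k\<bar>) < m" if "i \<le> CARD('n)" for i
    unfolding m_def using member_le_sum[of i "{0..CARD('n)}" "\<lambda>i. \<Sum>k\<in>UNIV. \<bar>a i $ k\<bar>"] that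
    by (force intro: sum_nonneg)
  show thesis
  proof (rule that)
    show "m * Y > 0"
      using m Y by simp
    fix b i
    assume lf: "lattice_free_body (row_polyhedron a b)" and b: "\<And>i. i \<le> CARD('n) \<Longrightarrow> b i \<ge> 0"
      and i: "i \<le> CARD('n)"
    define t where "t = (\<Sum>j=0..CARD('n). of_int (y j) * b j) / Y"
    have tY: "t * Y = (\<Sum>j=0..CARD('n). of_int (y j) * b j)"
      using Y by (simp add: t_def)
    have "(\<Sum>j=0..CARD('n). of_int (y j) * (b j - t)) = (\<Sum>j=0..CARD('n). of_int (y j) * b j) - t * Y"
      unfolding Y_def by (simp add: sum_subtractf sum_distrib_left right_diff_distrib mult.commute)
    then have "(\<Sum>j=0..CARD('n). of_int (y j) * (b j - t)) = 0"
      using tY by simp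
    then obtain x where x: "\<And>j. j \<le> CARD('n) \<Longrightarrow> a j \<bullet> x = b j - t"
      by (rule solvable_row_values) (rule that)
    define z :: "real^'n" where "z = (\<chi> k. of_int \<lfloor>x $ k\<rfloor>)"
    have z: "z \<in> integer_points"
      by (simp add: z_def integer_points_def)
    have "t \<le> m"
    proof (rule ccontr)
      assume "\<not> t \<le> m"
      have "a j \<bullet> z < b j" if j: "j \<le> CARD('n)" for j
      proof -
        have "a j \<bullet> (z - x) \<le> (\<Sum>k\<in>UNIV. \<bar>a j $ k\<bar> * 1)"
          unfolding inner_vec_def inner_real_def
        proof (rule sum_mono)
          fix k
          have "\<bar>(z - x) $ k\<bar> \<le> 1"
            by (simp add: z_def) linarith
          then have "\<bar>a j $ k\<bar> * \<bar>(z - x) $ k\<bar> \<le> \<bar>a j $ k\<bar> * 1"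
            by (intro mult_left_mono) auto
          then show "a j $ k * (z - x) $ k \<le> \<bar>a j $ k\<bar> * 1"
            by (metis abs_ge_self abs_mult order_trans)
        qed
        then show ?thesis
          using row_m[OF j] x[OF j] \<open>\<not> t \<le> m\<close> by (simp add: inner_diff_right)
      qed
      then have "z \<in> interior (row_polyhedron a b)"
        by (simp add: interior_row_polyhedron)
      then show False
        using lf z by (auto simp: lattice_free_body_def)
    qed
    have "b i \<le> of_int (y i) * b i"
      using y_ge_1[OF i] b[OF i] mult_right_mono[of 1 "of_int (y i)" "b i"] by simp
    also have "\<dots> \<le> t * Y"
      unfolding tY using i b y_ge_1 by (intro member_le_sum) (force intro!: mult_nonneg_nonneg)+
    also have "\<dots> \<le> m * Y"
      using \<open>t \<le> m\<close> Y by simp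
    finally show "b i \<le> m * Y" .
  qed
qed

text \<open>Moving facet i outwards by 1/2 gives a strictly larger convex body L, which by maximality has a
  lattice point in its interior. By integrality row i of that point is at most \<open>b\<^sub>i\<close>, and it
  cannot be smaller, since \<open>K\<^sub>b\<close> itself is lattice free.\<close>

lemma lattice_point_on_facet:
  fixes b :: "nat \<Rightarrow> int"
  assumes max: "maximal_lattice_free_body (row_polyhedron a (\<lambda>i. of_int (b i)))" and i: "i \<le> CARD('n)"
  obtains z where "z \<in> integer_points" "a i \<bullet> z = of_int (b i)"
    and "\<And>j. j \<le> CARD('n) \<Longrightarrow> j \<noteq> i \<Longrightarrow> a j \<bullet> z < of_int (b j)"
proof -
  define K where "K = row_polyhedron a (\<lambda>i. of_int (b i))"
  define b' where "b' = (\<lambda>j. if j = i then of_int (b i) + 1/2 else real_of_int (b j))"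
  define L where "L = row_polyhedron a b'"
  have intK: "interior K \<noteq> {}" "interior K \<inter> integer_points = {}"
    using max by (auto simp: K_def maximal_lattice_free_body_def lattice_free_body_def convex_body_def)
  have KL: "K \<subseteq> L"
    by (force simp: K_def L_def row_polyhedron_def b'_def)
  obtain x where x: "x \<in> K"
    using intK(1) interior_subset by blast
  obtain v where v: "a i \<bullet> v = 1" "\<And>j. j \<le> CARD('n) \<Longrightarrow> j \<noteq> i \<Longrightarrow> a j \<bullet> v \<le> 0"
    using direction_leaving_one_facet[OF i] by blast
  \<comment> \<open>The step from x along v that ends on the shifted facet, so that L is larger than K.\<close>
  define s where "s = of_int (b i) + 1/2 - a i \<bullet> x"
  have x_le: "a j \<bullet> x \<le> of_int (b j)" if "j \<le> CARD('n)" for j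
    using x that by (simp add: K_def row_polyhedron_def)
  have s: "s > 0"
    using x_le[OF i] by (simp add: s_def)
  have "a j \<bullet> (x + s *\<^sub>R v) \<le> b' j" if j: "j \<le> CARD('n)" for j
  proof (cases "j = i")
    case True
    then show ?thesis
      using v(1) by (simp add: inner_add_right b'_def s_def)
  next
    case False
    then have "s * (a j \<bullet> v) \<le> 0"
      using v(2)[OF j False] s by (simp add: mult_le_0_iff)
    then show ?thesis
      using False x_le[OF j] by (simp add: inner_add_right b'_def)
  qed
  then have "x + s *\<^sub>R v \<in> L"
    by (simp add: L_def row_polyhedron_def)
  moreover have "x + s *\<^sub>R v \<notin> K"
    using v(1) i by (force simp: K_def row_polyhedron_def inner_add_right s_def)
  ultimately have "\<not> lattice_free_body L"
    using max KL unfolding maximal_lattice_free_body_def K_def[symmetric] by blast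
  moreover have "convex_body L"
    using interior_mono[OF KL] intK(1) compact_row_polyhedron
    by (auto simp: convex_body_def L_def row_polyhedron_as_halfspaces intro!: convex_INT convex_halfspace_le)
  ultimately obtain z where z: "z \<in> integer_points" "z \<in> interior L"
    unfolding lattice_free_body_def by blast
  have zb: "a j \<bullet> z < b' j" if "j \<le> CARD('n)" for j
    using z(2) that by (simp add: L_def interior_row_polyhedron)
  have off: "a j \<bullet> z < of_int (b j)" if "j \<le> CARD('n)" "j \<noteq> i" for j
    using zb that by (metis b'_def)
  have "z \<notin> interior K"
    using intK(2) z(1) by blast
  then have "\<not> a i \<bullet> z < of_int (b i)"
    using off unfolding K_def interior_row_polyhedron by fastforce
  moreover have "a i \<bullet> z \<le> of_int (b i)"
    using row_value_le_pred_iff[OF z(1) i, of "b i + 1"] zb[OF i] by (simp add: b'_def)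
  ultimately have "a i \<bullet> z = of_int (b i)"
    by simp
  then show thesis
    using that z(1) off by blast
qed

section \<open>The perturbed objective\<close>

lemma perturbed_objective_inner:
  "perturbed_objective a \<epsilon> \<bullet> x = a 0 \<bullet> x + (\<Sum>i=1..CARD('n). \<epsilon> ^ i * (a i \<bullet> x))"
  unfolding perturbed_objective_def inner_sum_left
  by (subst sum.atLeast_Suc_atMost) simp_all

text \<open>On points whose rows \<open>1, \<dots>, d\<close> are bounded above and with \<open>\<bar>a\<^sub>0 x\<bar> \<ge> 1\<close>, the unperturbed objective decides the sign.
  When \<open>a\<^sub>0 x \<le> -1\<close> the perturbation is at most the sum of the \<open>\<epsilon>\<^sup>i B\<close>, which is below 1. When
  \<open>a\<^sub>0 x \<ge> 1\<close> the rows have no lower bound independent of x, but the relation y bounds them below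
  by a multiple of \<open>- a\<^sub>0 x\<close>, so the perturbation is still smaller in size than \<open>a\<^sub>0 x\<close>.\<close>

lemma perturbed_objective_sign:
  assumes B: "B > 0"
  obtains \<epsilon>0 where "\<epsilon>0 > 0"
    and "\<And>\<epsilon> x. 0 < \<epsilon> \<Longrightarrow> \<epsilon> < \<epsilon>0 \<Longrightarrow> \<forall>i\<in>{1..CARD('n)}. a i \<bullet> x \<le> B \<Longrightarrow> a 0 \<bullet> x \<le> - 1 \<Longrightarrow>
          perturbed_objective a \<epsilon> \<bullet> x < 0"
    and "\<And>\<epsilon> x. 0 < \<epsilon> \<Longrightarrow> \<epsilon> < \<epsilon>0 \<Longrightarrow> \<forall>i\<in>{1..CARD('n)}. a i \<bullet> x \<le> B \<Longrightarrow> a 0 \<bullet> x \<ge> 1 \<Longrightarrow>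
          perturbed_objective a \<epsilon> \<bullet> x > 0"
proof -
  define S where "S = (\<Sum>j=1..CARD('n). real_of_int (y j))"
  define D where "D = B + of_int (y 0) + S * B"
  have y0: "of_int (y 0) \<ge> (0::real)" "S \<ge> 0"
    using y_pos by (auto intro!: sum_nonneg simp: less_imp_le S_def)
  have D: "D > 0" "B \<le> D"
    using B y0 by (simp_all add: D_def add_pos_nonneg)
  \<comment> \<open>The powers of \<open>\<epsilon>\<close> are at most \<open>\<epsilon>\<close>, so the total weight is at most \<open>\<epsilon> d D\<close>.\<close>
  define \<epsilon>0 where "\<epsilon>0 = min 1 (1 / (real CARD('n) * D))"
  have small: "(\<Sum>i=1..CARD('n). \<epsilon> ^ i * D) < 1" if \<epsilon>: "0 < \<epsilon>" "\<epsilon> < \<epsilon>0" for \<epsilon>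
  proof -
    have "(\<Sum>i=1..CARD('n). \<epsilon> ^ i * D) \<le> (\<Sum>i=1..CARD('n). \<epsilon> * D)"
    proof (intro sum_mono mult_right_mono)
      fix i assume "i \<in> {1..CARD('n)}"
      then show "\<epsilon> ^ i \<le> \<epsilon>"
        using power_decreasing[of 1 i \<epsilon>] \<epsilon> by (simp add: \<epsilon>0_def)
    qed (use D in simp)
    also have "\<dots> = \<epsilon> * (real CARD('n) * D)"
      by simp
    also have "\<dots> < 1"
      using \<epsilon> D by (simp add: \<epsilon>0_def pos_less_divide_eq)
    finally show ?thesis .
  qed
  show thesis
  proof (rule that[of \<epsilon>0])
    show "\<epsilon>0 > 0"
      using D by (simp add: \<epsilon>0_def)
  next
    fix \<epsilon> :: real and x
    assume \<epsilon>: "0 < \<epsilon>" "\<epsilon> < \<epsilon>0" and x: "\<forall>i\<in>{1..CARD('n)}. a i \<bullet> x \<le> B" and a0: "a 0 \<bullet> x \<le> - 1"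
    have "(\<Sum>i=1..CARD('n). \<epsilon> ^ i * (a i \<bullet> x)) \<le> (\<Sum>i=1..CARD('n). \<epsilon> ^ i * D)"
      using x D \<epsilon> by (intro sum_mono mult_left_mono) (auto intro: order_trans)
    then show "perturbed_objective a \<epsilon> \<bullet> x < 0"
      using small[OF \<epsilon>] a0 by (simp add: perturbed_objective_inner)
  next
    fix \<epsilon> :: real and x
    assume \<epsilon>: "0 < \<epsilon>" "\<epsilon> < \<epsilon>0" and x: "\<forall>i\<in>{1..CARD('n)}. a i \<bullet> x \<le> B" and a0: "a 0 \<bullet> x \<ge> 1"
    let ?M = "a 0 \<bullet> x"
    have low: "a i \<bullet> x \<ge> - (?M * D)" if i: "i \<in> {1..CARD('n)}" for i
    proof -
      have "B + S * B \<le> ?M * (B + S * B)"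
        using a0 B y0 mult_right_mono[of 1 ?M "B + S * B"] by simp
      then show ?thesis
        using row_value_lower_bound[OF _ _ i, of x B] x B a0 by (simp add: D_def S_def algebra_simps)
    qed
    have "(\<Sum>i=1..CARD('n). \<epsilon> ^ i * (a i \<bullet> x)) \<ge> (\<Sum>i=1..CARD('n). \<epsilon> ^ i * (- (?M * D)))"
      using low \<epsilon> by (intro sum_mono mult_left_mono) auto
    also have "(\<Sum>i=1..CARD('n). \<epsilon> ^ i * (- (?M * D))) = - (?M * (\<Sum>i=1..CARD('n). \<epsilon> ^ i * D))"
      by (simp add: sum_distrib_left sum_negf mult_ac)
    finally have "perturbed_objective a \<epsilon> \<bullet> x \<ge> ?M - ?M * (\<Sum>i=1..CARD('n). \<epsilon> ^ i * D)"
      by (simp add: perturbed_objective_inner)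
    moreover have "?M * (\<Sum>i=1..CARD('n). \<epsilon> ^ i * D) < ?M * 1"
      using small[OF \<epsilon>] a0 by (intro mult_strict_left_mono) auto
    ultimately show "perturbed_objective a \<epsilon> \<bullet> x > 0"
      by simp
  qed
qed

lemma feasible_imp_row_value_le:
  assumes "ip_feasible a b z" "i \<in> {1..CARD('n)}"
  shows "a i \<bullet> z \<le> of_int (b i)"
  using assms by (simp add: ip_feasible_def)

text \<open>The point z witnesses that 0 is no longer optimal when row i is relaxed by one. The vector that
  the test set then provides has to make use of the relaxation, because it improves on 0.\<close>

lemma test_vector_on_facet:
  fixes b :: "nat \<Rightarrow> int"
  assumes T: "test_set a c T"
    and opt: "ip_optimal a c (\<lambda>j. b j - 1) 0"
    and i: "i \<in> {1..CARD('n)}"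
    and z: "z \<in> integer_points" "a i \<bullet> z = of_int (b i)" "c \<bullet> z < 0"
      "\<And>j. j \<in> {1..CARD('n)} \<Longrightarrow> j \<noteq> i \<Longrightarrow> a j \<bullet> z < of_int (b j)"
  obtains v where "v \<in> T" "a i \<bullet> v = of_int (b i)"
    "\<And>j. j \<in> {1..CARD('n)} \<Longrightarrow> j \<noteq> i \<Longrightarrow> a j \<bullet> v < of_int (b j)"
proof -
  define b' where "b' = (\<lambda>j. b j - 1)(i := b i)"
  have lt: "a j \<bullet> w \<le> of_int (b j - 1) \<longleftrightarrow> a j \<bullet> w < of_int (b j)"
    if "w \<in> integer_points" "j \<in> {1..CARD('n)}" for j w
    using row_value_le_pred_iff[OF that(1)] that(2) by simp
  have feas0: "ip_feasible a (\<lambda>j. b j - 1) 0"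
    using opt by (simp add: ip_optimal_def)
  have "ip_feasible a b' 0"
    using feas0 by (force simp: ip_feasible_def b'_def)
  moreover have "ip_feasible a b' z"
    using z lt by (simp add: ip_feasible_def b'_def)
  then have "\<not> ip_optimal a c b' 0"
    using z(3) by (auto simp: ip_optimal_def not_le)
  ultimately obtain v where v: "v \<in> T" "ip_feasible a b' v"
    using T by (auto simp: test_set_def)
  have vZ: "v \<in> integer_points" and neg: "c \<bullet> v < 0"
    using v T by (auto simp: test_set_def)
  have off: "a j \<bullet> v < of_int (b j)" if "j \<in> {1..CARD('n)}" "j \<noteq> i" for j
    using feasible_imp_row_value_le[OF v(2) that(1)] lt[OF vZ that(1)] that(2) by (simp add: b'_def)
  have "\<not> ip_feasible a (\<lambda>j. b j - 1) v"
    using opt neg by (auto simp: ip_optimal_def not_le)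
  then have "\<not> a i \<bullet> v < of_int (b i)"
    using off lt[OF vZ] vZ unfolding ip_feasible_def by metis
  then have "a i \<bullet> v = of_int (b i)"
    using feasible_imp_row_value_le[OF v(2) i] by (simp add: b'_def)
  then show thesis
    using that v(1) off by blast
qed

end

section \<open>Maximal lattice free simplices and test sets\<close>

theorem theorem4p6:
  fixes a :: "nat \<Rightarrow> real^'n::finite" and y :: "nat \<Rightarrow> int"
  assumes integral: "\<forall>i\<in>{0..CARD('n)}. a i \<in> integer_points"
    and rank: "rows_rank a = CARD('n)"
    and y_pos: "\<forall>i\<in>{0..CARD('n)}. y i > 0"
    and y_rel: "(\<Sum>i=0..CARD('n). of_int (y i) *\<^sub>R a i) = 0"
  shows "\<exists>\<epsilon>0>0. \<forall>\<epsilon>::real. 0 < \<epsilon> \<and> \<epsilon> < \<epsilon>0 \<longrightarrow>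
    (\<forall>(T :: (real^'n) set) (b :: nat \<Rightarrow> nat).
      test_set a (perturbed_objective a \<epsilon>) T \<and>
      b 0 = 0 \<and> (\<forall>i\<in>{1..CARD('n)}. b i > 0) \<and>
      maximal_lattice_free_body (row_polyhedron a (\<lambda>i. real (b i))) \<and>
      ip_optimal a (perturbed_objective a \<epsilon>) (\<lambda>i. int (b i) - 1) 0 \<longrightarrow>
      (\<exists>z :: nat \<Rightarrow> real^'n.
        (\<forall>i\<in>{1..CARD('n)}. z i \<in> T) \<and>
        (\<forall>i\<in>{1..CARD('n)}. a i \<bullet> z i > 0) \<and>
        (\<forall>i\<in>{1..CARD('n)}. \<forall>j\<in>{1..CARD('n)}. j \<noteq> i \<longrightarrow> a i \<bullet> z j < a i \<bullet> z i) \<and>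
        \<not> (\<exists>w\<in>T. \<forall>k\<in>{1..CARD('n)}. a k \<bullet> w < a k \<bullet> z k) \<and>
        (\<forall>i\<in>{1..CARD('n)}. a 0 \<bullet> z i \<le> 0)))"
proof -
  interpret simplex_matrix a y
    using assms by unfold_locales
  obtain B where B: "B > 0"
    and bound: "\<And>b i. lattice_free_body (row_polyhedron a b) \<Longrightarrow> (\<And>i. i \<le> CARD('n) \<Longrightarrow> b i \<ge> 0) \<Longrightarrow>
          i \<le> CARD('n) \<Longrightarrow> b i \<le> B"
    using lattice_free_rhs_bounded by metis
  obtain \<epsilon>0 where \<epsilon>0: "\<epsilon>0 > 0"
    and neg: "\<And>\<epsilon> x. 0 < \<epsilon> \<Longrightarrow> \<epsilon> < \<epsilon>0 \<Longrightarrow> \<forall>i\<in>{1..CARD('n)}. a i \<bullet> x \<le> B \<Longrightarrow> a 0 \<bullet> x \<le> - 1 \<Longrightarrow>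
          perturbed_objective a \<epsilon> \<bullet> x < 0"
    and pos: "\<And>\<epsilon> x. 0 < \<epsilon> \<Longrightarrow> \<epsilon> < \<epsilon>0 \<Longrightarrow> \<forall>i\<in>{1..CARD('n)}. a i \<bullet> x \<le> B \<Longrightarrow> a 0 \<bullet> x \<ge> 1 \<Longrightarrow>
          perturbed_objective a \<epsilon> \<bullet> x > 0"
    using perturbed_objective_sign[OF B] by blast
  show ?thesis
  proof (intro exI[of _ \<epsilon>0] conjI allI impI \<epsilon>0; elim conjE)
    fix \<epsilon> :: real and T :: "(real^'n) set" and b :: "nat \<Rightarrow> nat"
    let ?c = "perturbed_objective a \<epsilon>"
    assume \<epsilon>: "0 < \<epsilon>" "\<epsilon> < \<epsilon>0" and T: "test_set a ?c T" and b0: "b 0 = 0"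
      and bpos: "\<forall>i\<in>{1..CARD('n)}. b i > 0"
      and max: "maximal_lattice_free_body (row_polyhedron a (\<lambda>i. real (b i)))"
      and opt: "ip_optimal a ?c (\<lambda>i. int (b i) - 1) 0"
    have bB: "real (b i) \<le> B" if "i \<le> CARD('n)" for i
      using bound[of "\<lambda>i. real (b i)" i] max that by (simp add: maximal_lattice_free_body_def)
    have "\<exists>v. v \<in> T \<and> a i \<bullet> v = real (b i) \<and> (\<forall>j\<in>{1..CARD('n)}. j \<noteq> i \<longrightarrow> a j \<bullet> v < real (b j))"
      if i: "i \<in> {1..CARD('n)}" for i
    proof -
      obtain z where z: "z \<in> integer_points" "a i \<bullet> z = real (b i)"
        and off: "\<And>j. j \<le> CARD('n) \<Longrightarrow> j \<noteq> i \<Longrightarrow> a j \<bullet> z < real (b j)"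
        using lattice_point_on_facet[of "\<lambda>i. int (b i)" i] max i by auto
      have le: "a j \<bullet> z \<le> B" if "j \<in> {1..CARD('n)}" for j
        using off[of j] z(2) bB[of j] that by (cases "j = i") auto
      have "a 0 \<bullet> z \<le> - 1"
        using row_value_le_pred_iff[OF z(1), of 0 0] off[of 0] i b0 by simp
      then have "?c \<bullet> z < 0"
        using neg[OF \<epsilon>] le by blast
      moreover have "a j \<bullet> z < of_int (int (b j))" if "j \<in> {1..CARD('n)}" "j \<noteq> i" for j
        using off that by simp
      ultimately obtain v where "v \<in> T" "a i \<bullet> v = of_int (int (b i))"
        "\<And>j. j \<in> {1..CARD('n)} \<Longrightarrow> j \<noteq> i \<Longrightarrow> a j \<bullet> v < of_int (int (b j))"
        using test_vector_on_facet[OF T opt i z(1)] z(2) by (metis of_int_of_nat_eq)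
      then show ?thesis
        by (intro exI[of _ v]) simp
    qed
    then obtain z where z: "\<And>i. i \<in> {1..CARD('n)} \<Longrightarrow> z i \<in> T"
      and on: "\<And>i. i \<in> {1..CARD('n)} \<Longrightarrow> a i \<bullet> z i = real (b i)"
      and off: "\<And>i j. i \<in> {1..CARD('n)} \<Longrightarrow> j \<in> {1..CARD('n)} \<Longrightarrow> j \<noteq> i \<Longrightarrow> a j \<bullet> z i < real (b j)"
      by metis
    have TZ: "w \<in> integer_points" "?c \<bullet> w < 0" if "w \<in> T" for w
      using T that by (auto simp: test_set_def)
    have a: "a i \<bullet> z i > 0" if "i \<in> {1..CARD('n)}" for i
      using on that bpos by simp
    have b: "a i \<bullet> z j < a i \<bullet> z i" if "i \<in> {1..CARD('n)}" "j \<in> {1..CARD('n)}" "j \<noteq> i" for i j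
      using on off that by metis
    have c: False if w: "w \<in> T" "\<forall>k\<in>{1..CARD('n)}. a k \<bullet> w < a k \<bullet> z k" for w
    proof -
      have "a k \<bullet> w \<le> of_int (int (b k) - 1)" if k: "k \<in> {1..CARD('n)}" for k
        using row_value_le_pred_iff[OF TZ(1)[OF w(1)], of k "int (b k)"] w(2) on[OF k] k by force
      then have "ip_feasible a (\<lambda>i. int (b i) - 1) w"
        using TZ w(1) by (simp add: ip_feasible_def)
      then show False
        using opt TZ(2)[OF w(1)] by (auto simp: ip_optimal_def not_le)
    qed
    then have c': "\<not> (\<exists>w\<in>T. \<forall>k\<in>{1..CARD('n)}. a k \<bullet> w < a k \<bullet> z k)"
      by blast
    have d: "a 0 \<bullet> z i \<le> 0" if i: "i \<in> {1..CARD('n)}" for i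
    proof (rule ccontr)
      assume gt: "\<not> a 0 \<bullet> z i \<le> 0"
      have "a 0 \<bullet> z i \<ge> 1"
        using row_value_le_pred_iff[OF TZ(1)[OF z[OF i]], of 0 1] gt by simp
      moreover have "a j \<bullet> z i \<le> B" if "j \<in> {1..CARD('n)}" for j
        using on[OF i] off[OF i that] bB[of j] that by (cases "j = i") auto
      ultimately show False
        using pos[OF \<epsilon>] TZ(2)[OF z[OF i]] by (metis less_asym)
    qed
    show "\<exists>z. (\<forall>i\<in>{1..CARD('n)}. z i \<in> T) \<and>
        (\<forall>i\<in>{1..CARD('n)}. a i \<bullet> z i > 0) \<and>
        (\<forall>i\<in>{1..CARD('n)}. \<forall>j\<in>{1..CARD('n)}. j \<noteq> i \<longrightarrow> a i \<bullet> z j < a i \<bullet> z i) \<and>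
        \<not> (\<exists>w\<in>T. \<forall>k\<in>{1..CARD('n)}. a k \<bullet> w < a k \<bullet> z k) \<and>
        (\<forall>i\<in>{1..CARD('n)}. a 0 \<bullet> z i \<le> 0)"
      by (intro exI[of _ z] conjI ballI impI z a b c' d)
  qed
qed

end
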